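(* Let $V:S^{n-1}\to S^{n-1}$ be a $b$-bistochastic quadratic stochastic operator with heredity coefficients $\{P_{ij,k}\}_{i,j,k=1}^n$. If $$P_{kk,k}<1 \quad\text{and}\quad P_{kj,k}<\tfrac12$$ for all $k\in\{1,\dots,n-1\}$ and all $j\in\{k+1,\dots,n\}$, then the fixed point $\mathbb{P}=(0,\dots,0,1)$ of $V$ is unique, i.e. $\mathbb{P}$ is the only fixed point of $V$ in $S^{n-1}$.
   Context: $S^{n-1}=\{\mathbf{x}=(x_1,\dots,x_n)\in\mathbb{R}^n : x_i\ge 0,\ \sum_{i=1}^n x_i=1\}$. For $\mathbf{x},\mathbf{y}\in S^{n-1}$ write $\mathbf{x}\le^b\mathbf{y}$ if $\sum_{i=1}^k x_i\le\sum_{i=1}^k y_i$ for all $k\in\{1,\dots,n-1\}$. A quadratic stochastic operator (q.s.o.) is a map $V:S^{n-1}\to S^{n-1}$ of the form $V(\mathbf{x})_k=\sum_{i,j=1}^n P_{ij,k}x_ix_j$, $k=1,\dots,n$, where the heredity coefficients satisfy $P_{ij,k}\ge 0$, $P_{ij,k}=P_{ji,k}$ and $\sum_{k=1}^n P_{ij,k}=1$ for all $i,j,k$. A q.s.o. $V$ is called $b$-bistochastic if $V(\mathbf{x})\le^b\mathbf{x}$ for all $\mathbf{x}\in S^{n-1}$. A fixed point of $V$ is a point $\mathbf{x}_0$ with $V(\mathbf{x}_0)=\mathbf{x}_0$. The point $\mathbb{P}=(0,\dots,0,1)$ is a fixed point of every $b$-bistochastic q.s.o. *)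

theory Defs
  imports Complex_Main "HOL-Library.FuncSet"
begin

(* A vector (x_1,...,x_n) is a function on nat that vanishes outside {1..n}.  This makes the
   representation unique, so equality of points of the simplex is equality of functions. *)
definition simplex :: "nat \<Rightarrow> (nat \<Rightarrow> real) set" where
  "simplex n = {x. (\<forall>i. i \<notin> {1..n} \<longrightarrow> x i = 0) \<and> (\<forall>i\<in>{1..n}. x i \<ge> 0) \<and> (\<Sum>i=1..n. x i) = 1}"

definition b_le :: "nat \<Rightarrow> (nat \<Rightarrow> real) \<Rightarrow> (nat \<Rightarrow> real) \<Rightarrow> bool" where
  "b_le n x y \<longleftrightarrow> (\<forall>k\<in>{1..n-1}. (\<Sum>i=1..k. x i) \<le> (\<Sum>i=1..k. y i))"

(* P i j k stands for P_{ij,k}; only its values at indices in {1..n} matter. *)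
definition heredity_coefficients :: "nat \<Rightarrow> (nat \<Rightarrow> nat \<Rightarrow> nat \<Rightarrow> real) \<Rightarrow> bool" where
  "heredity_coefficients n P \<longleftrightarrow>
     (\<forall>i\<in>{1..n}. \<forall>j\<in>{1..n}.
        (\<forall>k\<in>{1..n}. P i j k \<ge> 0 \<and> P i j k = P j i k) \<and> (\<Sum>k=1..n. P i j k) = 1)"

(* V is only meaningful on the simplex; its values elsewhere are unconstrained. *)
definition qso_with :: "nat \<Rightarrow> (nat \<Rightarrow> nat \<Rightarrow> nat \<Rightarrow> real) \<Rightarrow> ((nat \<Rightarrow> real) \<Rightarrow> (nat \<Rightarrow> real)) \<Rightarrow> bool" where
  "qso_with n P V \<longleftrightarrow>
     heredity_coefficients n P \<and>
     V \<in> simplex n \<rightarrow> simplex n \<and>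
     (\<forall>x\<in>simplex n. \<forall>k\<in>{1..n}. V x k = (\<Sum>i=1..n. \<Sum>j=1..n. P i j k * x i * x j))"

definition qso :: "nat \<Rightarrow> ((nat \<Rightarrow> real) \<Rightarrow> (nat \<Rightarrow> real)) \<Rightarrow> bool" where
  "qso n V \<longleftrightarrow> (\<exists>P. qso_with n P V)"

definition b_bistochastic :: "nat \<Rightarrow> ((nat \<Rightarrow> real) \<Rightarrow> (nat \<Rightarrow> real)) \<Rightarrow> bool" where
  "b_bistochastic n V \<longleftrightarrow> qso n V \<and> (\<forall>x\<in>simplex n. b_le n (V x) x)"

definition fixed_points :: "nat \<Rightarrow> ((nat \<Rightarrow> real) \<Rightarrow> (nat \<Rightarrow> real)) \<Rightarrow> (nat \<Rightarrow> real) set" where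
  "fixed_points n V = {x \<in> simplex n. V x = x}"

(* The point (0,...,0,1). *)
definition last_vertex :: "nat \<Rightarrow> nat \<Rightarrow> real" where
  "last_vertex n = (\<lambda>i. if i = n then 1 else 0)"

end

theory Submission imports Defs begin

text \<open>Testing b-bistochasticity at the midpoint of the vertices \<open>i, j > k\<close>, whose first \<open>k\<close>
  coordinates vanish, forces \<open>P i j k = 0\<close>. If \<open>x\<close> is a fixed point whose first positive coordinate
  is \<open>x k\<close> with \<open>k < n\<close>, then only the coefficients \<open>P k j k\<close> contribute to \<open>V x k\<close>, and the
  hypotheses give \<open>V x k < x k * (\<Sum>j. x j) = x k\<close>, a contradiction.\<close>

text \<open>The order bounds the \<open>k\<close>-th partial sum of \<open>V x\<close> by that of
  \<open>x\<close>, which is 0; a sum of nonnegative terms that is at most 0 has only zero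
  terms.\<close>

lemma b_bistochastic_vanish:
  assumes "b_bistochastic n V" "V \<in> simplex n \<rightarrow> simplex n" "x \<in> simplex n"
    and "k < n" "\<And>i. i \<in> {1..k} \<Longrightarrow> x i = 0" "i \<in> {1..k}"
  shows "V x i = 0"
proof -
  have "V x \<in> simplex n" using assms by auto
  then have nn: "\<And>m. m \<in> {1..k} \<Longrightarrow> 0 \<le> V x m"
    using \<open>k < n\<close> by (auto simp: simplex_def)
  have "k \<in> {1..n-1}" using assms(4,6) by auto
  then have "(\<Sum>m=1..k. V x m) \<le> (\<Sum>m=1..k. x m)"
    using assms(1,3) unfolding b_bistochastic_def b_le_def by blast
  also have "\<dots> = 0" using assms(5) by simp
  finally have zero: "(\<Sum>m=1..k. V x m) = 0"
    using nn by (intro antisym sum_nonneg) auto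
  show ?thesis
    by (rule sum_nonneg_0[OF finite_atLeastAtMost nn zero assms(6)])
qed

lemma b_bistochastic_coeff_eq_0:
  assumes V: "qso_with n P V" and b: "b_bistochastic n V"
    and ij: "i \<in> {k<..n}" "j \<in> {k<..n}" and k: "1 \<le> k"
  shows "P i j k = 0"
proof -
  \<comment> \<open>Adding two indicator terms also covers \<open>i = j\<close>, where
    \<open>y\<close> is the vertex itself; in every case \<open>y i\<close> and \<open>y j\<close>
    are positive.\<close>
  define y :: "nat \<Rightarrow> real"
    where "y = (\<lambda>m. (if m = i then 1/2 else 0) + (if m = j then 1/2 else 0))"
  have y_nn: "0 \<le> y m" for m by (simp add: y_def)
  have "(\<Sum>m=1..n. y m) = 1"
    using ij k by (simp add: y_def sum.distrib)
  then have y: "y \<in> simplex n"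
    using ij k y_nn by (auto simp: simplex_def y_def)
  have P_nn: "0 \<le> P a c k" if "a \<in> {1..n}" "c \<in> {1..n}" for a c
    using V that ij k unfolding qso_with_def heredity_coefficients_def by auto
  have "V y k = 0"
    using b V y ij k by (intro b_bistochastic_vanish[of n V y k]) (auto simp: qso_with_def y_def)
  moreover have "V y k = (\<Sum>(a,c)\<in>{1..n}\<times>{1..n}. P a c k * y a * y c)"
    using V y ij k by (auto simp: qso_with_def sum.cartesian_product)
  ultimately have "(\<Sum>(a,c)\<in>{1..n}\<times>{1..n}. P a c k * y a * y c) = 0"
    by simp
  \<comment> \<open>No cancellation is possible among nonnegative terms, so the \<open>(i,j)\<close>
    term vanishes by itself.\<close>
  then have "\<forall>p\<in>{1..n}\<times>{1..n}. (case p of (a,c) \<Rightarrow> P a c k * y a * y c) = 0"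
    by (subst (asm) sum_nonneg_eq_0_iff) (auto intro!: mult_nonneg_nonneg P_nn y_nn)
  then have "P i j k * y i * y j = 0" using ij k by auto
  then show ?thesis by (auto simp: y_def split: if_splits)
qed

lemma simplex_eq_last_vertex:
  assumes "x \<in> simplex n" "n \<ge> 1" "\<And>i. i \<in> {1..n-1} \<Longrightarrow> x i = 0"
  shows "x = last_vertex n"
proof -
  have "(\<Sum>i=1..n. x i) = (\<Sum>i=1..n-1. x i) + x n"
    using \<open>n \<ge> 1\<close> by (cases n) auto
  then have "x n = 1" using assms by (simp add: simplex_def)
  moreover have "x i = 0" if "i \<noteq> n" for i
    using assms that by (cases "i \<in> {1..n}") (auto simp: simplex_def)
  ultimately show ?thesis by (auto simp: last_vertex_def)
qed

lemma qso_less_at_first_positive: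
  assumes V: "qso_with n P V" and b: "b_bistochastic n V" and x: "x \<in> simplex n"
    and k: "k \<in> {1..n-1}" and pos: "x k > 0" and zero: "\<And>i. i < k \<Longrightarrow> x i = 0"
    and diag: "P k k k < 1" and row: "\<And>j. j \<in> {k+1..n} \<Longrightarrow> P k j k < 1/2"
  shows "V x k < x k"
proof -
  define I where "I = {1..n} \<times> {1..n}"
  \<comment> \<open>The weight 1/2 makes \<open>h i + h j\<close> equal to 1 at
    \<open>(k,k)\<close>, 1/2 elsewhere in row and column \<open>k\<close>, and 0 at all other
    pairs: the bounds given by \<open>diag\<close>, \<open>row\<close> and the vanishing of
    coefficients. Being a sum of one-variable terms, it gives a quadratic form that factors through
    \<open>\<Sum>j. x j = 1\<close>.\<close>
  define h :: "nat \<Rightarrow> real" where "h = (\<lambda>i. if i = k then 1/2 else 0)"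
  have kn: "k \<in> {1..n}" using k by auto
  have x_nn: "\<And>i. i \<in> {1..n} \<Longrightarrow> 0 \<le> x i" and x_sum: "(\<Sum>i=1..n. x i) = 1"
    using x by (auto simp: simplex_def)
  have P_sym: "P a c k = P c a k" if "a \<in> {1..n}" "c \<in> {1..n}" for a c
    using V that kn unfolding qso_with_def heredity_coefficients_def by blast
  have le: "P i j k * x i * x j \<le> (h i + h j) * x i * x j"
    if ij: "i \<in> {1..n}" "j \<in> {1..n}" for i j
  proof (cases "i < k \<or> j < k")
    case True
    then show ?thesis using zero by auto
  next
    case False
    \<comment> \<open>Both indices are now at least \<open>k\<close>. Symmetry reduces column
      \<open>k\<close> to row \<open>k\<close>; if both exceed \<open>k\<close>, the coefficient is
      0.\<close>
    have "P i j k \<le> h i + h j"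
    proof (cases "i = k \<or> j = k")
      case True
      then consider "i = k" "j = k" | "i = k" "j \<in> {k+1..n}" | "j = k" "i \<in> {k+1..n}"
        using False ij by fastforce
      then show ?thesis
        using diag row[of j] row[of i] P_sym[OF ij] by cases (auto simp: h_def)
    next
      case neither: False
      then have "P i j k = 0"
        using False ij k by (intro b_bistochastic_coeff_eq_0[OF V b]) auto
      with neither show ?thesis by (simp add: h_def)
    qed
    then show ?thesis using x_nn ij by (intro mult_right_mono) auto
  qed
  have "V x k = (\<Sum>(i,j)\<in>I. P i j k * x i * x j)"
    using V x kn by (auto simp: I_def qso_with_def sum.cartesian_product)
  also have "\<dots> < (\<Sum>(i,j)\<in>I. (h i + h j) * x i * x j)"
  proof (rule sum_strict_mono_ex1)
    \<comment> \<open>Strictness comes from the pair \<open>(k,k)\<close>, where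
      \<open>P k k k < 1\<close> and \<open>x k > 0\<close>.\<close>
    show "\<exists>p\<in>I. (case p of (i,j) \<Rightarrow> P i j k * x i * x j) < (case p of (i,j) \<Rightarrow> (h i + h j) * x i * x j)"
      using kn diag pos by (intro bexI[of _ "(k,k)"]) (auto simp: I_def h_def)
  qed (use le in \<open>auto simp: I_def\<close>)
  also have "\<dots> = (\<Sum>i=1..n. \<Sum>j=1..n. h i * x i * x j + x i * (h j * x j))"
    by (simp add: I_def sum.cartesian_product algebra_simps)
  also have "\<dots> = (\<Sum>i=1..n. h i * x i) * (\<Sum>j=1..n. x j) + (\<Sum>i=1..n. x i) * (\<Sum>j=1..n. h j * x j)"
    by (simp only: sum.distrib sum_product)
  also have "(\<Sum>i=1..n. h i * x i) = x k / 2"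
    using kn by (simp add: h_def if_distrib[of "\<lambda>t. t * _"] cong: if_cong)
  finally show ?thesis using x_sum by simp
qed

theorem theorem3p2:
  fixes n :: nat
    and P :: "nat \<Rightarrow> nat \<Rightarrow> nat \<Rightarrow> real"
    and V :: "(nat \<Rightarrow> real) \<Rightarrow> (nat \<Rightarrow> real)"
  assumes "n \<ge> 1"
    and "qso_with n P V"
    and "b_bistochastic n V"
    and "\<And>k. k \<in> {1..n-1} \<Longrightarrow> P k k k < 1"
    and "\<And>k j. k \<in> {1..n-1} \<Longrightarrow> j \<in> {k+1..n} \<Longrightarrow> P k j k < 1/2"
  shows "fixed_points n V = {last_vertex n}"
proof (intro equalityI subsetI)
  fix x assume "x \<in> fixed_points n V"
  then have x: "x \<in> simplex n" "V x = x" by (auto simp: fixed_points_def)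
  have "x i = 0" if i: "i \<in> {1..n-1}" for i
  proof (rule ccontr)
    assume "x i \<noteq> 0"
    \<comment> \<open>The minimum ranges over all naturals, but \<open>x\<close> vanishes outside
      \<open>{1..n}\<close>, so \<open>k\<close> is a genuine coordinate; \<open>k \<le> i\<close>
      keeps it below \<open>n\<close>.\<close>
    define k where "k = (LEAST m. x m \<noteq> 0)"
    have xk: "x k \<noteq> 0"
      unfolding k_def using \<open>x i \<noteq> 0\<close> by (rule LeastI)
    have zero: "x m = 0" if "m < k" for m
      using not_less_Least[of m "\<lambda>m. x m \<noteq> 0"] that unfolding k_def by blast
    have "k \<le> i" unfolding k_def using \<open>x i \<noteq> 0\<close> by (rule Least_le)
    moreover have "k \<in> {1..n} \<and> 0 < x k"
      using x(1) xk by (force simp: simplex_def)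
    ultimately have k: "k \<in> {1..n-1}" "0 < x k" using i by auto
    have "V x k < x k"
      using qso_less_at_first_positive[OF assms(2,3) x(1) k zero assms(4)[OF k(1)] assms(5)[OF k(1)]] .
    with x(2) show False by simp
  qed
  then show "x \<in> {last_vertex n}"
    using simplex_eq_last_vertex[OF x(1) assms(1)] by simp
next
  fix x assume x: "x \<in> {last_vertex n}"
  have e: "last_vertex n \<in> simplex n"
    using assms(1) by (auto simp: simplex_def last_vertex_def)
  have V: "V \<in> simplex n \<rightarrow> simplex n" using assms(2) by (simp add: qso_with_def)
  \<comment> \<open>The vertex is itself fixed: its first \<open>n-1\<close> coordinates are 0,
    hence so are those of its image, and the total mass 1 determines the last one.\<close>
  have "V (last_vertex n) i = 0" if "i \<in> {1..n-1}" for i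
    using assms(1) that
    by (intro b_bistochastic_vanish[OF assms(3) V e, of "n-1"]) (auto simp: last_vertex_def)
  then have "V (last_vertex n) = last_vertex n"
    using V e assms(1) by (intro simplex_eq_last_vertex) auto
  then show "x \<in> fixed_points n V" using x e by (simp add: fixed_points_def)
qed

end
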